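(* Let $N\ge2$ and $\ell\ge1$. Let the current snapshot be $\boldsymbol{x}=\boldsymbol{x}^*(\alpha)+\boldsymbol{z}$ with $\boldsymbol{z}\sim\mathcal{N}(\boldsymbol{0},C(\alpha))$, and let the baseline be the average $\boldsymbol{b}=\frac1\ell\sum_{r=1}^\ell\boldsymbol{x}^{(r)}(\alpha_0)$ of $\ell$ independent stationary snapshots at a fixed reference parameter $\alpha_0$, independent of the current snapshot, so that $\boldsymbol{b}=\boldsymbol{x}^*(\alpha_0)+\boldsymbol{\epsilon}$ with $\boldsymbol{\epsilon}\sim\mathcal{N}\big(\boldsymbol{0},C(\alpha_0)/\ell\big)$ independent of $\boldsymbol{z}$. Define $\boldsymbol{y}^\Delta=\boldsymbol{x}-\boldsymbol{b}$, $\boldsymbol{\delta}(\alpha)=\boldsymbol{x}^*(\alpha)-\boldsymbol{x}^*(\alpha_0)$ and $V_\Delta=\operatorname{Var}(\boldsymbol{y}^\Delta)$. Then $$\mathbb{E}[V_\Delta]=\operatorname{Var}(\boldsymbol{\delta}(\alpha))+\Phi(\alpha)+\frac1\ell\,\Phi(\alpha_0),$$ where $\Phi(\alpha)=\frac1{N-1}\operatorname{Tr}\big(P\,C(\alpha)\big)$.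
   Context: For $\boldsymbol{u}\in\mathbb{R}^N$, $\bar u=N^{-1}\sum_iu_i$ and $\operatorname{Var}(\boldsymbol{u})=\frac1{N-1}\sum_i(u_i-\bar u)^2$ (sample variance across components). $P=I-\frac1N\boldsymbol{1}\boldsymbol{1}^\top$. $\boldsymbol{x}^*(\alpha)\in\mathbb{R}^N$ is a deterministic equilibrium vector and $C(\alpha)$ the stationary covariance matrix at parameter $\alpha$; a stationary snapshot at $\alpha_0$ has law $\mathcal{N}(\boldsymbol{x}^*(\alpha_0),C(\alpha_0))$. *)

theory Defs
  imports "HOL-Probability.Probability"
begin

definition vmean :: "real ^ 'n \<Rightarrow> real" where
  "vmean u = (\<Sum>i\<in>UNIV. u $ i) / real CARD('n)"

definition sample_var :: "real ^ 'n \<Rightarrow> real" where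
  "sample_var u = (\<Sum>i\<in>UNIV. (u $ i - vmean u)\<^sup>2) / (real CARD('n) - 1)"

definition centering :: "real ^ 'n ^ 'n" where
  "centering = mat 1 - (1 / real CARD('n)) *\<^sub>R (\<chi> i j. 1)"

definition Phi :: "('p \<Rightarrow> real ^ 'n ^ 'n) \<Rightarrow> 'p \<Rightarrow> real" where
  "Phi C \<alpha> = trace (centering ** C \<alpha>) / (real CARD('n) - 1)"

(* One-dimensional normal law with mean m and VARIANCE v (normal_density takes the
   standard deviation); for v = 0 it is the point mass at m. *)
definition normal_law :: "real \<Rightarrow> real \<Rightarrow> real measure" where
  "normal_law m v =
     (if v = 0 then return borel m
      else density lborel (\<lambda>x. ennreal (normal_density m (sqrt v) x)))"

definition covariance_matrix :: "real ^ 'n ^ 'n \<Rightarrow> bool" where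
  "covariance_matrix S \<longleftrightarrow> transpose S = S \<and> (\<forall>a. 0 \<le> a \<bullet> (S *v a))"

(* X ~ N(m, S): every linear functional of X is normal with the matching mean and variance.
   This determines the law of X and allows singular S, for which no Lebesgue density exists. *)
definition multivariate_normal ::
    "'w measure \<Rightarrow> ('w \<Rightarrow> real ^ 'n) \<Rightarrow> real ^ 'n \<Rightarrow> real ^ 'n ^ 'n \<Rightarrow> bool" where
  "multivariate_normal M X m S \<longleftrightarrow>
     X \<in> borel_measurable M \<and> covariance_matrix S \<and>
     (\<forall>a. distr M borel (\<lambda>\<omega>. a \<bullet> X \<omega>) = normal_law (a \<bullet> m) (a \<bullet> (S *v a)))"

end

(*
  The identity u_i - mean u = p_i \<bullet> u, with p_i the i-th row of P, writes (N - 1) Var(u) as the sum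
  of the squares (p_i \<bullet> u)^2.  Independent combinations of Gaussian vectors are Gaussian (by
  characteristic functions), so y ~ N(\<delta>, S) with S = C(\<alpha>) + C(\<alpha>0)/l and each p_i \<bullet> y has second
  moment (p_i \<bullet> \<delta>)^2 + p_i \<bullet> S p_i; the latter terms sum to Tr(P S P) = Tr(P S).
*)
theory Submission imports Defs begin

section \<open>One-dimensional normal laws, degenerate case included\<close>

text \<open>An affine image of the standard normal covers \<open>v = 0\<close> as well, the map then
  being constant. Characteristic function and moments can thus be computed without a case
  split.\<close>

lemma normal_law_eq_distr:
  assumes "v \<ge> 0"
  shows "normal_law m v = distr std_normal_distribution borel (\<lambda>x. m + sqrt v * x)"
proof -
  interpret real_distribution std_normal_distribution
    by (rule real_dist_normal_dist)
  show ?thesis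
  proof (cases "v = 0")
    case True
    then show ?thesis
      by (simp add: normal_law_def)
  next
    case False
    have "distributed std_normal_distribution lborel (\<lambda>x. x) std_normal_density"
      by (simp add: distributed_def distr_id2)
    \<comment> \<open>The affine rule for densities needs a nonzero scale factor, which is why
      \<open>v = 0\<close> was treated apart.\<close>
    from normal_density_affine[OF this, of "sqrt v" m] show ?thesis
      using False assms by (simp add: distributed_def normal_law_def cong: distr_cong)
  qed
qed

lemma real_distribution_normal_law: "v \<ge> 0 \<Longrightarrow> real_distribution (normal_law m v)"
proof -
  interpret real_distribution std_normal_distribution
    by (rule real_dist_normal_dist)
  show "v \<ge> 0 \<Longrightarrow> ?thesis"
    by (auto simp: normal_law_eq_distr intro!: real_distribution_distr)
qed

lemma (in prob_space) char_distr_add_const: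
  assumes [measurable]: "X \<in> borel_measurable M"
  shows "char (distr M borel (\<lambda>\<omega>. k + X \<omega>)) t = iexp (t * k) * char (distr M borel X) t"
  by (simp add: char_def integral_distr distrib_left exp_add)

lemma char_normal_law:
  assumes "v \<ge> 0"
  shows "char (normal_law m v) t = exp (\<i> * of_real (t * m) - of_real (t\<^sup>2 * v / 2))"
proof -
  interpret real_distribution std_normal_distribution
    by (rule real_dist_normal_dist)
  have "char (normal_law m v) t = iexp (t * m) * char (distr std_normal_distribution borel ((*) (sqrt v))) t"
    using char_distr_add_const[of "(*) (sqrt v)" m t] by (simp add: normal_law_eq_distr assms)
  also have "char (distr std_normal_distribution borel ((*) (sqrt v))) t = char std_normal_distribution (t * sqrt v)"
    by (simp add: char_def integral_distr mult.assoc)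
  also have "\<dots> = exp (- of_real (t\<^sup>2 * v / 2))"
    using assms by (simp add: char_std_normal_distribution power_mult_distrib flip: exp_of_real of_real_power)
  finally show ?thesis
    by (simp flip: exp_add)
qed

text \<open>Expanding the square of \<open>m + sqrt v * x\<close> reduces this to the first two
  moments, 0 and 1, of the standard normal.\<close>

lemma normal_law_second_moment:
  assumes "v \<ge> 0"
  shows "integrable (normal_law m v) (\<lambda>x. x\<^sup>2)" "(LINT x|normal_law m v. x\<^sup>2) = m\<^sup>2 + v"
proof -
  interpret real_distribution std_normal_distribution
    by (rule real_dist_normal_dist)
  have eq: "(m + sqrt v * x)\<^sup>2 = m\<^sup>2 + (2 * m * sqrt v) * x + v * x\<^sup>2" for x
    using assms by (simp add: power2_sum power_mult_distrib)
  have int: "integrable std_normal_distribution (\<lambda>x. x)" "integrable std_normal_distribution (\<lambda>x. x\<^sup>2)"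
    using integrable_std_normal_distribution_moment[of 1] integrable_std_normal_distribution_moment[of 2] by simp_all
  \<comment> \<open>The even moment of order 2k is (2k)! / (2^k k!), which equals 1 for k =
    1.\<close>
  have mom: "(LINT x|std_normal_distribution. x) = 0" "(LINT x|std_normal_distribution. x\<^sup>2) = 1"
    using integral_std_normal_distribution_moment_odd[of 1]
      std_normal_distribution_even_moments(1)[of 1] by (simp_all add: fact_numeral)
  have "has_bochner_integral std_normal_distribution (\<lambda>x. (m + sqrt v * x)\<^sup>2)
      (m\<^sup>2 + (2 * m * sqrt v) * 0 + v * 1)"
    unfolding eq
    by (intro has_bochner_integral_add has_bochner_integral_mult_right)
      (use int mom prob_space in \<open>auto simp: has_bochner_integral_iff\<close>)
  then show "integrable (normal_law m v) (\<lambda>x. x\<^sup>2)" "(LINT x|normal_law m v. x\<^sup>2) = m\<^sup>2 + v"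
    unfolding normal_law_eq_distr[OF assms]
    by (simp_all add: integrable_distr_eq integral_distr has_bochner_integral_iff)
qed

section \<open>Affine images and independent sums of Gaussian vectors\<close>

text \<open>This is the covariance of a combination of independent vectors with coefficients
  \<open>c i\<close>. The quadratic form is linear in the matrix, and the squared coefficients keep
  it nonnegative.\<close>

lemma covariance_matrix_sum:
  assumes "\<And>i. i \<in> I \<Longrightarrow> covariance_matrix (S i)"
  shows "covariance_matrix (\<Sum>i\<in>I. (c i)\<^sup>2 *\<^sub>R S i)"
    and "a \<bullet> ((\<Sum>i\<in>I. (c i)\<^sup>2 *\<^sub>R S i) *v a) = (\<Sum>i\<in>I. (c i)\<^sup>2 * (a \<bullet> (S i *v a)))"
proof -
  have quad: "a \<bullet> ((\<Sum>i\<in>I. (c i)\<^sup>2 *\<^sub>R S i) *v a) = (\<Sum>i\<in>I. (c i)\<^sup>2 * (a \<bullet> (S i *v a)))" for a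
    \<comment> \<open>For infinite \<open>I\<close> both sums are 0 by convention.\<close>
    by (induction I rule: infinite_finite_induct)
      (simp_all add: matrix_vector_mult_add_rdistrib inner_add_right flip: scaleR_matrix_vector_assoc)
  then show "a \<bullet> ((\<Sum>i\<in>I. (c i)\<^sup>2 *\<^sub>R S i) *v a) = (\<Sum>i\<in>I. (c i)\<^sup>2 * (a \<bullet> (S i *v a)))" .
  have sym: "S i $ k $ j = S i $ j $ k" if "i \<in> I" for i j k
  proof -
    have "transpose (S i) $ k $ j = S i $ k $ j"
      using assms[OF that] by (simp add: covariance_matrix_def)
    then show ?thesis
      by (simp add: transpose_def)
  qed
  have "transpose (\<Sum>i\<in>I. (c i)\<^sup>2 *\<^sub>R S i) = (\<Sum>i\<in>I. (c i)\<^sup>2 *\<^sub>R S i)"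
    unfolding vec_eq_iff transpose_def by (auto intro!: sum.cong simp: sym)
  moreover have "0 \<le> (\<Sum>i\<in>I. (c i)\<^sup>2 * (a \<bullet> (S i *v a)))" for a
    using assms by (intro sum_nonneg mult_nonneg_nonneg) (auto simp: covariance_matrix_def)
  ultimately show "covariance_matrix (\<Sum>i\<in>I. (c i)\<^sup>2 *\<^sub>R S i)"
    unfolding covariance_matrix_def quad by blast
qed

text \<open>A shift by \<open>k\<close> multiplies the characteristic function of each functional by
  a phase, which is absorbed into the mean; Levy uniqueness then identifies the law.\<close>

lemma (in prob_space) multivariate_normal_add_const:
  assumes "multivariate_normal M X m S"
  shows "multivariate_normal M (\<lambda>\<omega>. k + X \<omega>) (k + m) S"
proof -
  have [measurable]: "X \<in> borel_measurable M"
    using assms by (simp add: multivariate_normal_def)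
  have "distr M borel (\<lambda>\<omega>. a \<bullet> (k + X \<omega>)) = normal_law (a \<bullet> (k + m)) (a \<bullet> (S *v a))" for a
  proof (rule Levy_uniqueness)
    have v: "a \<bullet> (S *v a) \<ge> 0"
      using assms by (simp add: multivariate_normal_def covariance_matrix_def)
    then show "real_distribution (normal_law (a \<bullet> (k + m)) (a \<bullet> (S *v a)))"
      by (rule real_distribution_normal_law)
    show "char (distr M borel (\<lambda>\<omega>. a \<bullet> (k + X \<omega>))) = char (normal_law (a \<bullet> (k + m)) (a \<bullet> (S *v a)))"
      using assms char_distr_add_const[of "\<lambda>\<omega>. a \<bullet> X \<omega>" "a \<bullet> k"] v
      by (simp add: multivariate_normal_def inner_add_right char_normal_law distrib_left fun_eq_iff
          add_diff_eq flip: exp_add)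
  qed (auto intro!: real_distribution_distr)
  then show ?thesis
    using assms by (simp add: multivariate_normal_def)
qed

text \<open>Along a fixed \<open>a\<close> the summands are independent scalars, so their
  characteristic functions multiply. The exponents add up to that of the normal law with summed mean
  and variance, and Levy uniqueness concludes.\<close>

lemma (in prob_space) multivariate_normal_sum:
  assumes fin: "finite I"
    and X: "\<And>i. i \<in> I \<Longrightarrow> multivariate_normal M (X i) (m i) (S i)"
    and indep: "indep_vars (\<lambda>_. borel) X I"
  shows "multivariate_normal M (\<lambda>\<omega>. \<Sum>i\<in>I. c i *\<^sub>R X i \<omega>) (\<Sum>i\<in>I. c i *\<^sub>R m i) (\<Sum>i\<in>I. (c i)\<^sup>2 *\<^sub>R S i)"
proof -
  have cov: "covariance_matrix (S i)" and [measurable]: "X i \<in> borel_measurable M" if "i \<in> I" for i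
    using X[OF that] by (simp_all add: multivariate_normal_def)
  define m' S' where "m' = (\<Sum>i\<in>I. c i *\<^sub>R m i)" and "S' = (\<Sum>i\<in>I. (c i)\<^sup>2 *\<^sub>R S i)"
  have S': "covariance_matrix S'"
    unfolding S'_def using cov by (rule covariance_matrix_sum)
  have "distr M borel (\<lambda>\<omega>. a \<bullet> (\<Sum>i\<in>I. c i *\<^sub>R X i \<omega>)) = normal_law (a \<bullet> m') (a \<bullet> (S' *v a))" for a
  proof (rule Levy_uniqueness)
    have v: "a \<bullet> (S' *v a) \<ge> 0"
      using S' by (simp add: covariance_matrix_def)
    then show "real_distribution (normal_law (a \<bullet> m') (a \<bullet> (S' *v a)))"
      by (rule real_distribution_normal_law)
    show "char (distr M borel (\<lambda>\<omega>. a \<bullet> (\<Sum>i\<in>I. c i *\<^sub>R X i \<omega>))) = char (normal_law (a \<bullet> m') (a \<bullet> (S' *v a)))"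
    proof
      fix t
      \<comment> \<open>Moving \<open>c i\<close> into the functional lets the normality of
        \<open>X i\<close> be used directly, at the vector \<open>c i *\<^sub>R a\<close>.\<close>
      have "indep_vars (\<lambda>_. borel) (\<lambda>i \<omega>. (c i *\<^sub>R a) \<bullet> X i \<omega>) I"
        using indep by (rule indep_vars_compose2) simp
      from char_distr_sum[OF this, of t]
      have "char (distr M borel (\<lambda>\<omega>. a \<bullet> (\<Sum>i\<in>I. c i *\<^sub>R X i \<omega>))) t
          = (\<Prod>i\<in>I. char (distr M borel (\<lambda>\<omega>. (c i *\<^sub>R a) \<bullet> X i \<omega>)) t)"
        by (simp add: inner_sum_right)
      also have "\<dots> = (\<Prod>i\<in>I. exp (\<i> * of_real (t * (c i * (a \<bullet> m i))) - of_real (t\<^sup>2 * ((c i)\<^sup>2 * (a \<bullet> (S i *v a))) / 2)))"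
      proof (rule prod.cong[OF refl])
        fix i assume i: "i \<in> I"
        have "distr M borel (\<lambda>\<omega>. (c i *\<^sub>R a) \<bullet> X i \<omega>)
            = normal_law ((c i *\<^sub>R a) \<bullet> m i) ((c i *\<^sub>R a) \<bullet> (S i *v (c i *\<^sub>R a)))"
          using X[OF i] unfolding multivariate_normal_def by blast
        also have "(c i *\<^sub>R a) \<bullet> (S i *v (c i *\<^sub>R a)) = (c i)\<^sup>2 * (a \<bullet> (S i *v a))"
          by (simp add: matrix_vector_mult_scaleR power2_eq_square)
        finally show "char (distr M borel (\<lambda>\<omega>. (c i *\<^sub>R a) \<bullet> X i \<omega>)) t
            = exp (\<i> * of_real (t * (c i * (a \<bullet> m i))) - of_real (t\<^sup>2 * ((c i)\<^sup>2 * (a \<bullet> (S i *v a))) / 2))"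
          using cov[OF i] by (simp add: char_normal_law covariance_matrix_def)
      qed
      also have "\<dots> = char (normal_law (a \<bullet> m') (a \<bullet> (S' *v a))) t"
        using v covariance_matrix_sum(2)[of I S a c, OF cov]
        by (simp add: fin char_normal_law m'_def S'_def inner_sum_right sum_subtractf sum_distrib_left
            sum_divide_distrib flip: exp_sum)
      finally show "char (distr M borel (\<lambda>\<omega>. a \<bullet> (\<Sum>i\<in>I. c i *\<^sub>R X i \<omega>))) t
          = char (normal_law (a \<bullet> m') (a \<bullet> (S' *v a))) t" .
    qed
  qed (auto intro!: real_distribution_distr)
  with S' show ?thesis
    by (simp add: multivariate_normal_def m'_def S'_def)
qed

section \<open>The centering matrix and traces\<close>

lemma centering_nth: "(centering :: real^'n^'n) $ i $ j = (if i = j then 1 else 0) - 1 / real CARD('n)"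
  by (simp add: centering_def mat_def)

lemma inner_row_centering: "row i centering \<bullet> u = u $ i - vmean u" for u :: "real^'n"
proof -
  have "row i centering \<bullet> u = (\<Sum>j\<in>UNIV. (if i = j then u $ j else 0) - u $ j / real CARD('n))"
    unfolding inner_vec_def row_def
    by (intro sum.cong) (simp_all add: centering_nth left_diff_distrib)
  then show ?thesis
    by (simp add: sum_subtractf vmean_def sum_divide_distrib)
qed

lemma sample_var_eq_row_centering:
  "sample_var u = (\<Sum>i\<in>UNIV. (row i centering \<bullet> u)\<^sup>2) / (real CARD('n) - 1)" for u :: "real^'n"
  by (simp add: sample_var_def inner_row_centering)

lemma transpose_centering: "transpose centering = centering"
  by (simp add: transpose_def vec_eq_iff centering_nth)

text \<open>Each column of \<open>centering\<close> has mean 0, so subtracting its mean leaves it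
  unchanged.\<close>

lemma centering_idem: "centering ** centering = (centering :: real^'n^'n)"
proof -
  have "(centering ** centering :: real^'n^'n) $ i $ j = centering $ i $ j" for i j
  proof -
    have "vmean (column j (centering :: real^'n^'n)) = 0"
      by (simp add: vmean_def column_def centering_nth sum_subtractf)
    then have "row i (centering :: real^'n^'n) \<bullet> column j centering = centering $ i $ j"
      \<comment> \<open>The column stays folded in the first call, so that its zero mean can be used
        before entries are expanded.\<close>
      by (simp add: inner_row_centering) (simp add: column_def)
    then show ?thesis
      by (simp add: matrix_matrix_mult_def inner_vec_def row_def column_def)
  qed
  then show ?thesis
    by (simp add: vec_eq_iff)
qed

text \<open>Each diagonal entry of the congruence is the quadratic form of \<open>S\<close> at a row
  of \<open>A\<close>. If \<open>S\<close> is the covariance of X, these are the variances of the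
  coordinates of A X.\<close>

lemma trace_congruence: "trace (A ** S ** transpose A) = (\<Sum>i\<in>UNIV. row i A \<bullet> (S *v row i A))"
  for A :: "real^'n^'m"
proof -
  have "(A ** S ** transpose A) $ i $ i = row i A \<bullet> (S *v row i A)" for i
    by (simp add: matrix_matrix_mult_def matrix_vector_mult_def transpose_def row_def inner_vec_def
        sum_distrib_left sum_distrib_right mult.assoc) (rule sum.swap)
  then show ?thesis
    by (simp add: trace_def)
qed

text \<open>Idempotence doubles the factor P, cyclicity of the trace moves one copy to the right,
  and symmetry of P makes the result a congruence.\<close>

lemma trace_centering: "trace (centering ** S) = (\<Sum>i\<in>UNIV. row i centering \<bullet> (S *v row i centering))"
proof -
  have "trace (centering ** S) = trace (centering ** (centering ** S))"
    by (simp add: matrix_mul_assoc centering_idem)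
  also have "\<dots> = trace (centering ** S ** centering)"
    by (rule trace_mul_sym)
  finally show ?thesis
    using trace_congruence[of centering S] by (simp add: transpose_centering)
qed

section \<open>Expected sample variance of a Gaussian vector\<close>

lemma (in prob_space) multivariate_normal_second_moment:
  assumes "multivariate_normal M X m S"
  shows "integrable M (\<lambda>\<omega>. (a \<bullet> X \<omega>)\<^sup>2)" "expectation (\<lambda>\<omega>. (a \<bullet> X \<omega>)\<^sup>2) = (a \<bullet> m)\<^sup>2 + a \<bullet> (S *v a)"
proof -
  have [measurable]: "X \<in> borel_measurable M" and v: "a \<bullet> (S *v a) \<ge> 0"
    and law: "distr M borel (\<lambda>\<omega>. a \<bullet> X \<omega>) = normal_law (a \<bullet> m) (a \<bullet> (S *v a))"
    using assms by (auto simp: multivariate_normal_def covariance_matrix_def)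
  show "integrable M (\<lambda>\<omega>. (a \<bullet> X \<omega>)\<^sup>2)"
    using normal_law_second_moment(1)[OF v, of "a \<bullet> m"] by (simp add: integrable_distr_eq flip: law)
  show "expectation (\<lambda>\<omega>. (a \<bullet> X \<omega>)\<^sup>2) = (a \<bullet> m)\<^sup>2 + a \<bullet> (S *v a)"
    using normal_law_second_moment(2)[OF v, of "a \<bullet> m"] by (simp add: integral_distr flip: law)
qed

text \<open>Summed over the rows of \<open>centering\<close>, the squared means reassemble to
  \<open>sample_var m\<close> and the variances to the trace.\<close>

lemma (in prob_space) multivariate_normal_sample_var:
  fixes X :: "'a \<Rightarrow> real^'n"
  assumes "multivariate_normal M X m S"
  shows "integrable M (\<lambda>\<omega>. sample_var (X \<omega>))"
    and "expectation (\<lambda>\<omega>. sample_var (X \<omega>)) = sample_var m + trace (centering ** S) / (real CARD('n) - 1)"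
  unfolding sample_var_eq_row_centering trace_centering
  by (simp_all add: multivariate_normal_second_moment[OF assms] sum.distrib add_divide_distrib)

theorem proposition7p1:
  fixes M :: "'w measure"
    and xstar :: "'p \<Rightarrow> real ^ 'n"
    and C :: "'p \<Rightarrow> real ^ 'n ^ 'n"
    and \<alpha> \<alpha>0 :: 'p
    and l :: nat
    and x z b \<epsilon> y :: "'w \<Rightarrow> real ^ 'n"
    and xs :: "nat \<Rightarrow> 'w \<Rightarrow> real ^ 'n"
    and \<delta> :: "'p \<Rightarrow> real ^ 'n"
    and V :: "'w \<Rightarrow> real"
  assumes "prob_space M"
    and "CARD('n) \<ge> 2"
    and "l \<ge> 1"
    and "x = (\<lambda>\<omega>. xstar \<alpha> + z \<omega>)"
    and "multivariate_normal M z 0 (C \<alpha>)"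
    and "\<forall>r\<in>{1..l}. multivariate_normal M (xs r) (xstar \<alpha>0) (C \<alpha>0)"
    and "prob_space.indep_vars M (\<lambda>_. borel) (\<lambda>r. if r = 0 then x else xs r) {0..l}"
    and "b = (\<lambda>\<omega>. (1 / real l) *\<^sub>R (\<Sum>r=1..l. xs r \<omega>))"
    and "\<epsilon> = (\<lambda>\<omega>. b \<omega> - xstar \<alpha>0)"
    and "y = (\<lambda>\<omega>. x \<omega> - b \<omega>)"
    and "\<delta> = (\<lambda>\<beta>. xstar \<beta> - xstar \<alpha>0)"
    and "V = (\<lambda>\<omega>. sample_var (y \<omega>))"
  shows "multivariate_normal M \<epsilon> 0 ((1 / real l) *\<^sub>R C \<alpha>0)
    \<and> prob_space.indep_var M borel \<epsilon> borel z
    \<and> integrable M V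
    \<and> prob_space.expectation M V = sample_var (\<delta> \<alpha>) + Phi C \<alpha> + 1 / real l * Phi C \<alpha>0"
proof -
  interpret prob_space M by fact
  \<comment> \<open>One family holds all the data: index 0 is the current snapshot, indices 1 to
    \<open>l\<close> the baseline snapshots.\<close>
  define X where "X = (\<lambda>r. if r = 0 then x else xs r)"
  define m where "m = (\<lambda>r::nat. if r = 0 then xstar \<alpha> else xstar \<alpha>0)"
  define S where "S = (\<lambda>r::nat. if r = 0 then C \<alpha> else C \<alpha>0)"
  \<comment> \<open>The coefficients that express \<open>y\<close> through \<open>X\<close>; the
    sign disappears in the squares that weight the covariances.\<close>
  define c where "c = (\<lambda>r::nat. if r = 0 then 1 else - (1 / real l))"
  have l: "real l > 0"
    using \<open>l \<ge> 1\<close> by simp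
  have indep: "indep_vars (\<lambda>_. borel) X {0..l}"
    unfolding X_def by fact
  have "multivariate_normal M x (xstar \<alpha>) (C \<alpha>)"
    using multivariate_normal_add_const[OF assms(5), of "xstar \<alpha>"] by (simp add: assms(4))
  then have X: "multivariate_normal M (X r) (m r) (S r)" if "r \<in> {0..l}" for r
    using that assms(6) by (simp add: X_def m_def S_def)
  have set: "{0..l} = insert 0 {1..l}"
    by auto

  have "multivariate_normal M b (xstar \<alpha>0) ((1 / real l) *\<^sub>R C \<alpha>0)"
  proof -
    have "multivariate_normal M (\<lambda>\<omega>. \<Sum>r=1..l. (1 / real l) *\<^sub>R X r \<omega>)
        (\<Sum>r=1..l. (1 / real l) *\<^sub>R m r) (\<Sum>r=1..l. (1 / real l)\<^sup>2 *\<^sub>R S r)"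
      by (rule multivariate_normal_sum[OF _ X indep_vars_subset[OF indep]]) auto
    moreover have "(\<lambda>\<omega>. \<Sum>r=1..l. (1 / real l) *\<^sub>R X r \<omega>) = b"
      by (simp add: X_def assms(8) scaleR_sum_right)
    moreover have "(\<Sum>r=1..l. (1 / real l) *\<^sub>R m r) = xstar \<alpha>0"
      \<comment> \<open>On vectors \<open>sum_constant\<close> would produce a componentwise product
        instead of a scalar multiple.\<close>
      using l by (simp add: m_def sum_constant_scaleR del: sum_constant)
    moreover have "(\<Sum>r=1..l. (1 / real l)\<^sup>2 *\<^sub>R S r) = (1 / real l) *\<^sub>R C \<alpha>0"
      using l by (simp add: S_def sum_constant_scaleR power2_eq_square del: sum_constant)
    ultimately show ?thesis
      by simp
  qed
  from multivariate_normal_add_const[OF this, of "- xstar \<alpha>0"]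
  have eps: "multivariate_normal M \<epsilon> 0 ((1 / real l) *\<^sub>R C \<alpha>0)"
    by (simp add: assms(9))

  \<comment> \<open>\<open>\<epsilon>\<close> is a measurable function of the block {1..l} and
    \<open>z\<close> of the block {0}; disjoint blocks of an independent family are
    independent.\<close>
  have "indep_var
      borel ((\<lambda>f. (1 / real l) *\<^sub>R (\<Sum>r=1..l. f r) - xstar \<alpha>0) \<circ> (\<lambda>\<omega>. restrict (\<lambda>r. X r \<omega>) {1..l}))
      borel ((\<lambda>f. f 0 - xstar \<alpha>) \<circ> (\<lambda>\<omega>. restrict (\<lambda>r. X r \<omega>) {0}))"
    by (intro indep_var_compose[OF indep_var_restrict[OF indep]]) auto
  also have "((\<lambda>f. f 0 - xstar \<alpha>) \<circ> (\<lambda>\<omega>. restrict (\<lambda>r. X r \<omega>) {0})) = z"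
    by (simp add: X_def assms(4) fun_eq_iff)
  also have "((\<lambda>f. (1 / real l) *\<^sub>R (\<Sum>r=1..l. f r) - xstar \<alpha>0) \<circ> (\<lambda>\<omega>. restrict (\<lambda>r. X r \<omega>) {1..l})) = \<epsilon>"
    by (simp add: X_def assms(8,9) fun_eq_iff)
  finally have ind: "indep_var borel \<epsilon> borel z" .

  have y: "multivariate_normal M y (\<delta> \<alpha>) (C \<alpha> + (1 / real l) *\<^sub>R C \<alpha>0)"
  proof -
    have "multivariate_normal M (\<lambda>\<omega>. \<Sum>r=0..l. c r *\<^sub>R X r \<omega>) (\<Sum>r=0..l. c r *\<^sub>R m r) (\<Sum>r=0..l. (c r)\<^sup>2 *\<^sub>R S r)"
      by (rule multivariate_normal_sum[OF _ X indep]) auto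
    moreover have "(\<lambda>\<omega>. \<Sum>r=0..l. c r *\<^sub>R X r \<omega>) = y"
      by (simp add: set X_def c_def assms(8,10) scaleR_sum_right sum_negf)
    moreover have "(\<Sum>r=0..l. c r *\<^sub>R m r) = \<delta> \<alpha>"
      using l by (simp add: set m_def c_def assms(11) sum_constant_scaleR del: sum_constant)
    moreover have "(\<Sum>r=0..l. (c r)\<^sup>2 *\<^sub>R S r) = C \<alpha> + (1 / real l) *\<^sub>R C \<alpha>0"
      \<comment> \<open>The \<open>l\<close> baseline terms, each weighted by 1/l^2, leave the
        factor 1/l.\<close>
      using l by (simp add: set S_def c_def sum_constant_scaleR power2_eq_square del: sum_constant)
    ultimately show ?thesis
      by simp
  qed
  have "trace (centering ** (C \<alpha> + (1 / real l) *\<^sub>R C \<alpha>0))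
      = trace (centering ** C \<alpha>) + 1 / real l * trace (centering ** C \<alpha>0)"
    by (simp add: trace_centering matrix_vector_mult_add_rdistrib inner_add_right sum.distrib
        sum_divide_distrib flip: scaleR_matrix_vector_assoc)
  then have "expectation V = sample_var (\<delta> \<alpha>) + Phi C \<alpha> + 1 / real l * Phi C \<alpha>0"
    unfolding assms(12) multivariate_normal_sample_var(2)[OF y] Phi_def
    by (simp add: add_divide_distrib)
  with eps ind multivariate_normal_sample_var(1)[OF y] show ?thesis
    by (simp add: assms(12))
qed

end
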